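(* Let $n\ge 1$, let $u,v$ be $n\times 1$ vectors over $Z_4$, and let $D$ be the $2^{(2n+4)-4}$ QC design determined by $u$ and $v$ (see context), with words of type $x=x_1x_2x_3x_4\in\{0,1\}^4$, and with $\lambda_1,\ldots,\lambda_{10}$, $l_1,\ldots,l_{10}$, $\rho_1,\rho_2,\xi_1,\xi_2,\xi$ as defined in the context. Then the following hold, where in each case all words of type $x$ are accounted for. (a) For $x=0000$, there is no word of type $x$. (b) For each of $x=0100$ and $1000$, there are exactly $1/\rho_1^2$ words of type $x$; every such word has aliasing index $\rho_1$ and length $l_1+1$. (c) For each of $x=0001$ and $0010$, there are exactly $1/\rho_2^2$ words of type $x$; every such word has aliasing index $\rho_2$ and length $l_2+1$. (d) For each of $x=0111$ and $1011$, there are exactly $1/\rho_1^2$ words of type $x$; every such word has aliasing index $\rho_1$ and length $l_3+3$. (e) For each of $x=1101$ and $1110$, there are exactly $1/\rho_2^2$ words of type $x$; every such word has aliasing index $\rho_2$ and length $l_4+3$. (f) For $x=1100$, there is exactly one word of type $x$, with aliasing index $1$ and length $l_5+2$. (g) For $x=0011$, there is exactly one word of type $x$, with aliasing index $1$ and length $l_6+2$. (h) For $x=1111$, there is exactly one word of type $x$, with aliasing index $1$ and length $l_7+4$. (i) For each of $x=0101$ and $1010$: (i1) if $\lambda_5+\lambda_6=0$, then there are exactly $1/(\xi_1^2\xi_2^2)$ words of type $x$; every such word has aliasing index $\xi_1\xi_2$ and length $l_8+2$; (i2) if $\lambda_5+\lambda_6>0$ and $\lambda_1+\lambda_2+\lambda_3+\lambda_4=0$,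 then there is exactly one word of type $x$, with aliasing index $1$ and length $l_{10}+2$; (i3) if $\lambda_5+\lambda_6>0$ and $\lambda_1+\lambda_2+\lambda_3+\lambda_4>0$, then there are exactly $1/\xi^2$ words of type $x$, each with aliasing index $\xi$; half of these words have length $l_9+2$ and the rest have length $l_{10}+2$. (j) For each of $x=0110$ and $1001$: (j1) if $\lambda_5+\lambda_6=0$, then there are exactly $1/(\xi_1^2\xi_2^2)$ words of type $x$; every such word has aliasing index $\xi_1\xi_2$ and length $l_8+2$; (j2) if $\lambda_5+\lambda_6>0$ and $\lambda_1+\lambda_2+\lambda_3+\lambda_4=0$, then there is exactly one word of type $x$, with aliasing index $1$ and length $l_9+2$; (j3) if $\lambda_5+\lambda_6>0$ and $\lambda_1+\lambda_2+\lambda_3+\lambda_4>0$, then there are exactly $1/\xi^2$ words of type $x$, each with aliasing index $\xi$; half of these words have length $l_9+2$ and the rest have length $l_{10}+2$.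
   Context: $Z_4=\{0,1,2,3\}$ with arithmetic mod 4. Let $u=(u_1,\ldots,u_n)'$, $v=(v_1,\ldots,v_n)'$ be vectors over $Z_4$ (prime denotes transpose). The design $D$: let $C=\{(a'u,a'v,a_1,\ldots,a_n): a=(a_1,\ldots,a_n)'\in Z_4^n\}$, with $a'u,a'v$ reduced mod 4 (codewords indexed by $a\in Z_4^n$). The Gray map replaces each element of $Z_4$ by a pair: $0\to(1,1)$, $1\to(1,-1)$, $2\to(-1,-1)$, $3\to(-1,1)$. Applying it entrywise to the codewords of $C$ gives a $2^{2n}\times(2n+4)$ matrix $D$ with entries $\pm1$, called a $2^{(2n+4)-4}$ QC design. Its rows are runs and its columns are factors, named in order $F_1,F_2,F_3,F_4,F_{11},F_{12},\ldots,F_{n1},F_{n2}$ (so $F_1,F_2$ come from $a'u$; $F_3,F_4$ from $a'v$; $F_{j1},F_{j2}$ from $a_j$). Columns are distinguished by their positions, even if they coincide as vectors. Words: let $N=2^{2n}$. For a nonempty set $S$ of $k$ columns, its aliasing index is $\frac1N\left|\sum_{s=1}^N\prod_{c\in S}c_s\right|$, where $c_s$ is the $s$th entry of column $c$. If it is nonzero, $S$ is called a word of length $k$ with that aliasing index. $S$ is of type $x=x_1x_2x_3x_4$, where $x_k=1$ if $F_k\in S$ and $x_k=0$ otherwise ($1\le k\le4$). Notation: for $0\le k,s\le3$, $f_{ks}=\#\{j:1\le j\le n,\ u_j=k,\ v_j=s\}$. Put $\lambda_1=f_{10}+f_{30}$, $\lambda_2=f_{01}+f_{03}$, $\lambda_3=f_{12}+f_{32}$,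 $\lambda_4=f_{21}+f_{23}$, $\lambda_5=f_{11}+f_{33}$, $\lambda_6=f_{13}+f_{31}$, $\lambda_7=f_{02}$, $\lambda_8=f_{20}$, $\lambda_9=f_{22}$, $\lambda_{10}=f_{00}$; $l_1=2(\lambda_4+\lambda_8+\lambda_9)+\lambda_1+\lambda_3+\lambda_5+\lambda_6$, $l_2=2(\lambda_3+\lambda_7+\lambda_9)+\lambda_2+\lambda_4+\lambda_5+\lambda_6$, $l_3=2(\lambda_2+\lambda_8+\lambda_9)+\lambda_1+\lambda_3+\lambda_5+\lambda_6$, $l_4=2(\lambda_1+\lambda_7+\lambda_9)+\lambda_2+\lambda_4+\lambda_5+\lambda_6$, $l_5=2(\lambda_1+\lambda_3+\lambda_5+\lambda_6)$, $l_6=2(\lambda_2+\lambda_4+\lambda_5+\lambda_6)$, $l_7=2(\lambda_1+\lambda_2+\lambda_3+\lambda_4)$, $l_8=2(\lambda_7+\lambda_8)+\lambda_1+\lambda_2+\lambda_3+\lambda_4$, $l_9=2(\lambda_5+\lambda_7+\lambda_8)+\lambda_1+\lambda_2+\lambda_3+\lambda_4$, $l_{10}=2(\lambda_6+\lambda_7+\lambda_8)+\lambda_1+\lambda_2+\lambda_3+\lambda_4$; and, with $\lfloor y\rfloor$ the largest integer not exceeding $y$, $\rho_1=2^{-\lfloor(\lambda_1+\lambda_3+\lambda_5+\lambda_6)/2\rfloor}$, $\rho_2=2^{-\lfloor(\lambda_2+\lambda_4+\lambda_5+\lambda_6)/2\rfloor}$, $\xi_1=2^{-\lfloor(\lambda_1+\lambda_3)/2\rfloor}$,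 $\xi_2=2^{-\lfloor(\lambda_2+\lambda_4)/2\rfloor}$, $\xi=2^{-\lfloor(\lambda_1+\lambda_2+\lambda_3+\lambda_4+1)/2\rfloor}$. *)

theory Defs
  imports "HOL-Analysis.Analysis"
begin

text \<open>
  The numeral type \<open>4\<close> is the ring of integers modulo 4, so \<open>4 ^ 'n\<close> is the set of vectors of
  length \<open>n = CARD('n) \<ge> 1\<close> over it.
\<close>

definition gray :: "4 \<Rightarrow> int \<times> int" where
  "gray z = (if z = 0 then (1, 1)
             else if z = 1 then (1, -1)
             else if z = 2 then (-1, -1)
             else (-1, 1))"

text \<open>
  The columns are identified by their names, so that equal columns in different positions remain
  distinct; \<open>Fj1 j\<close> and \<open>Fj2 j\<close> are the two columns that come from the entry \<open>a $ j\<close>.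
\<close>

datatype 'n factor = F1 | F2 | F3 | F4 | Fj1 'n | Fj2 'n

lemma UNIV_factor: "(UNIV :: 'n factor set) = {F1, F2, F3, F4} \<union> range Fj1 \<union> range Fj2"
proof -
  have "x \<in> {F1, F2, F3, F4} \<union> range Fj1 \<union> range Fj2" for x :: "'n factor"
    by (cases x) auto
  then show ?thesis by blast
qed

instance factor :: (finite) finite
  by standard (simp add: UNIV_factor)

lemma card_factor: "CARD('n::finite factor) = 2 * CARD('n) + 4"
proof -
  have "card (range Fj1 \<union> range Fj2 :: 'n factor set) = CARD('n) + CARD('n)"
    by (subst card_Un_disjoint) (auto simp: card_image inj_on_def)
  moreover have "card ({F1, F2, F3, F4} \<union> (range Fj1 \<union> range Fj2) :: 'n factor set)
      = card {F1, F2, F3, F4 :: 'n factor} + card (range Fj1 \<union> range Fj2 :: 'n factor set)"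
    by (rule card_Un_disjoint) auto
  ultimately show ?thesis
    by (simp add: UNIV_factor Un_assoc)
qed

text \<open>
  The row of the design indexed by \<open>a\<close> is the entrywise Gray image of the codeword
  \<open>(a'u, a'v, a\<^sub>1, \<dots>, a\<^sub>n)\<close>.
\<close>

primrec design :: "4 ^ 'n \<Rightarrow> 4 ^ 'n \<Rightarrow> 4 ^ 'n \<Rightarrow> 'n factor \<Rightarrow> int" where
  "design u v a F1 = fst (gray (scalar_product a u))"
| "design u v a F2 = snd (gray (scalar_product a u))"
| "design u v a F3 = fst (gray (scalar_product a v))"
| "design u v a F4 = snd (gray (scalar_product a v))"
| "design u v a (Fj1 j) = fst (gray (a $ j))"
| "design u v a (Fj2 j) = snd (gray (a $ j))"

definition aliasing_index :: "4 ^ 'n \<Rightarrow> 4 ^ 'n \<Rightarrow> 'n factor set \<Rightarrow> real" where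
  "aliasing_index u v S =
     1 / 2 ^ (2 * CARD('n)) * real_of_int \<bar>\<Sum>a\<in>UNIV. \<Prod>c\<in>S. design u v a c\<bar>"

definition is_word :: "4 ^ 'n \<Rightarrow> 4 ^ 'n \<Rightarrow> 'n factor set \<Rightarrow> bool" where
  "is_word u v S \<longleftrightarrow> S \<noteq> {} \<and> aliasing_index u v S \<noteq> 0"

definition factor_type :: "'n factor set \<Rightarrow> nat \<times> nat \<times> nat \<times> nat" where
  "factor_type S = (of_bool (F1 \<in> S), of_bool (F2 \<in> S), of_bool (F3 \<in> S), of_bool (F4 \<in> S))"

definition words :: "4 ^ 'n \<Rightarrow> 4 ^ 'n \<Rightarrow> nat \<times> nat \<times> nat \<times> nat \<Rightarrow> 'n factor set set" where
  "words u v x = {S. is_word u v S \<and> factor_type S = x}"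

text \<open>There are exactly \<open>N\<close> words of type \<open>x\<close>, all of aliasing index \<open>r\<close> and length \<open>k\<close>.\<close>

definition words_uniform ::
    "4 ^ 'n \<Rightarrow> 4 ^ 'n \<Rightarrow> nat \<times> nat \<times> nat \<times> nat \<Rightarrow> real \<Rightarrow> real \<Rightarrow> nat \<Rightarrow> bool" where
  "words_uniform u v x N r k \<longleftrightarrow>
     real (card (words u v x)) = N \<and>
     (\<forall>S\<in>words u v x. aliasing_index u v S = r \<and> card S = k)"

text \<open>
  There are exactly \<open>N\<close> words of type \<open>x\<close>, all of aliasing index \<open>r\<close>; half of them have length \<open>k\<close>
  and the rest length \<open>k'\<close>. The half is given as a subset because \<open>k = k'\<close> is possible.
\<close>

definition words_half_half ::
    "4 ^ 'n \<Rightarrow> 4 ^ 'n \<Rightarrow> nat \<times> nat \<times> nat \<times> nat \<Rightarrow> real \<Rightarrow> real \<Rightarrow> nat \<Rightarrow> nat \<Rightarrow> bool" where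
  "words_half_half u v x N r k k' \<longleftrightarrow>
     real (card (words u v x)) = N \<and>
     (\<forall>S\<in>words u v x. aliasing_index u v S = r) \<and>
     (\<exists>A\<subseteq>words u v x. 2 * card A = card (words u v x) \<and>
        (\<forall>S\<in>A. card S = k) \<and> (\<forall>S\<in>words u v x - A. card S = k'))"

context
  fixes u v :: "4 ^ 'n"
begin

definition freq :: "4 \<Rightarrow> 4 \<Rightarrow> nat" where
  "freq k s = card {j. u $ j = k \<and> v $ j = s}"

definition lam1 :: nat where "lam1 = freq 1 0 + freq 3 0"
definition lam2 :: nat where "lam2 = freq 0 1 + freq 0 3"
definition lam3 :: nat where "lam3 = freq 1 2 + freq 3 2"
definition lam4 :: nat where "lam4 = freq 2 1 + freq 2 3"
definition lam5 :: nat where "lam5 = freq 1 1 + freq 3 3"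
definition lam6 :: nat where "lam6 = freq 1 3 + freq 3 1"
definition lam7 :: nat where "lam7 = freq 0 2"
definition lam8 :: nat where "lam8 = freq 2 0"
definition lam9 :: nat where "lam9 = freq 2 2"
definition lam10 :: nat where "lam10 = freq 0 0"

definition l1 :: nat where "l1 = 2 * (lam4 + lam8 + lam9) + lam1 + lam3 + lam5 + lam6"
definition l2 :: nat where "l2 = 2 * (lam3 + lam7 + lam9) + lam2 + lam4 + lam5 + lam6"
definition l3 :: nat where "l3 = 2 * (lam2 + lam8 + lam9) + lam1 + lam3 + lam5 + lam6"
definition l4 :: nat where "l4 = 2 * (lam1 + lam7 + lam9) + lam2 + lam4 + lam5 + lam6"
definition l5 :: nat where "l5 = 2 * (lam1 + lam3 + lam5 + lam6)"
definition l6 :: nat where "l6 = 2 * (lam2 + lam4 + lam5 + lam6)"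
definition l7 :: nat where "l7 = 2 * (lam1 + lam2 + lam3 + lam4)"
definition l8 :: nat where "l8 = 2 * (lam7 + lam8) + lam1 + lam2 + lam3 + lam4"
definition l9 :: nat where "l9 = 2 * (lam5 + lam7 + lam8) + lam1 + lam2 + lam3 + lam4"
definition l10 :: nat where "l10 = 2 * (lam6 + lam7 + lam8) + lam1 + lam2 + lam3 + lam4"

definition rho1 :: real where "rho1 = 2 powi - \<lfloor>real (lam1 + lam3 + lam5 + lam6) / 2\<rfloor>"
definition rho2 :: real where "rho2 = 2 powi - \<lfloor>real (lam2 + lam4 + lam5 + lam6) / 2\<rfloor>"
definition xi1 :: real where "xi1 = 2 powi - \<lfloor>real (lam1 + lam3) / 2\<rfloor>"
definition xi2 :: real where "xi2 = 2 powi - \<lfloor>real (lam2 + lam4) / 2\<rfloor>"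
definition xi :: real where "xi = 2 powi - \<lfloor>real (lam1 + lam2 + lam3 + lam4 + 1) / 2\<rfloor>"

end

end

theory Submission
  imports Defs
begin

text \<open>
  Let \<open>f\<close> be the product of those columns of a set of columns that lie among \<open>F1\<close>, \<open>F2\<close>, \<open>F3\<close>, \<open>F4\<close>.
  The aliasing index is the absolute value of a coefficient of \<open>f\<close> with respect to the orthogonal
  basis of products of the remaining columns. Since \<open>f\<close> has values \<open>1\<close> and \<open>-1\<close>, Parseval's identity
  shows that the number of words of a type is \<open>1 / r\<^sup>2\<close> as soon as all of them have aliasing index \<open>r\<close>.

  The entries of the Gray map are the real parts of \<open>(1 - \<i>) \<chi>(z)\<close> and \<open>(1 + \<i>) \<chi>(z)\<close>, where
  \<open>\<chi>(z)\<close> is the \<open>z\<close>-th power of \<open>\<i>\<close>. Hence \<open>f\<close> is the real part of a multiple of a character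
  \<open>\<chi>(a'w)\<close>, or, for the types of (i) and (j), a sum of two such terms with \<open>w = u + v\<close> and
  \<open>w = u - v\<close>. The coefficients of a character are products over the entries of \<open>w\<close>: a nonzero one is
  a unit times the power of \<open>(1 + \<i>) / 2\<close> whose exponent is the number of odd entries of \<open>w\<close>, and it
  occurs only if the number of columns is the Lee weight of \<open>w\<close>. In (i) and (j), if no index has
  \<open>u\<close> and \<open>v\<close> both odd, the sum factorizes into two real parts; otherwise the two characters have
  disjoint supports, and Parseval's identity for each of them gives the two halves.
\<close>

section \<open>The character of Z4 and its coefficients on a single entry\<close>

lemma exhaust_Z4: "(z::4) = 0 \<or> z = 1 \<or> z = 2 \<or> z = 3"
  using exhaust_4[of z] by auto

lemma Z4_numeral_reduce [simp]:
  "(4::4) = 0" "(5::4) = 1" "(6::4) = 2" "(8::4) = 0" "(9::4) = 1" "(12::4) = 0"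
  "- (1::4) = 3" "- (2::4) = 2" "- (3::4) = 1"
  by simp_all

definition chi :: "4 \<Rightarrow> complex" where
  "chi z = (if z = 0 then 1 else if z = 1 then \<i> else if z = 2 then -1 else -\<i>)"

lemma chi_simps [simp]: "chi 0 = 1" "chi 1 = \<i>" "chi 2 = -1" "chi 3 = -\<i>"
  by (simp_all add: chi_def)

lemma chi_add: "chi (x + y) = chi x * chi y"
  using exhaust_Z4[of x] exhaust_Z4[of y] by (elim disjE) simp_all

lemma chi_uminus: "chi (- x) = cnj (chi x)"
  using exhaust_Z4[of x] by (elim disjE) simp_all

lemma chi_sum: "finite A \<Longrightarrow> chi (sum f A) = (\<Prod>i\<in>A. chi (f i))"
  by (induction A rule: finite_induct) (simp_all add: chi_add)

lemma gray_simps [simp]: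
  "gray 0 = (1, 1)" "gray 1 = (1, -1)" "gray 2 = (-1, -1)" "gray 3 = (-1, 1)"
  by (simp_all add: gray_def)

lemma fst_gray: "real_of_int (fst (gray z)) = Re ((1 - \<i>) * chi z)"
  using exhaust_Z4[of z] by (elim disjE) simp_all

lemma snd_gray: "real_of_int (snd (gray z)) = Re ((1 + \<i>) * chi z)"
  using exhaust_Z4[of z] by (elim disjE) simp_all

definition gray_factor :: "bool \<Rightarrow> bool \<Rightarrow> 4 \<Rightarrow> int" where
  "gray_factor b1 b2 z = (if b1 then fst (gray z) else 1) * (if b2 then snd (gray z) else 1)"

text \<open>The Walsh coefficient of the character \<open>chi (c * z)\<close> on one entry; the
  flags say which of the two Gray columns of that entry are used.\<close>

definition local_coeff :: "4 \<Rightarrow> bool \<Rightarrow> bool \<Rightarrow> complex" where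
  "local_coeff c b1 b2 = (\<Sum>z\<in>UNIV. chi (c * z) * of_int (gray_factor b1 b2 z)) / 4"

text \<open>For even \<open>c\<close> the character is itself a column product: the constant 1 for
  0, the product of both columns for 2. For odd \<open>c\<close> it is spread over the two single
  columns.\<close>

lemma local_coeff_simps [simp]:
  "local_coeff 0 b1 b2 = of_bool (\<not> b1 \<and> \<not> b2)"
  "local_coeff 2 b1 b2 = of_bool (b1 \<and> b2)"
  "local_coeff 1 b1 b2 = (if b1 = b2 then 0 else if b1 then (1 + \<i>) / 2 else (1 - \<i>) / 2)"
  "local_coeff 3 b1 b2 = (if b1 = b2 then 0 else if b1 then (1 - \<i>) / 2 else (1 + \<i>) / 2)"
  by (cases b1; cases b2; simp add: local_coeff_def sum_4 gray_factor_def)+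

lemma local_coeff_uminus: "local_coeff (- c) b1 b2 = cnj (local_coeff c b1 b2)"
  using exhaust_Z4[of c] by (elim disjE; cases b1; cases b2; simp)

subsection \<open>Walsh coefficients\<close>

definition entry_cols :: "'n factor set" where
  "entry_cols = range Fj1 \<union> range Fj2"

lemma prod_entry_cols:
  fixes B :: "'n::finite factor set" and f :: "'n factor \<Rightarrow> 'b::comm_monoid_mult"
  assumes "B \<subseteq> entry_cols"
  shows "prod f B = (\<Prod>j\<in>UNIV. (if Fj1 j \<in> B then f (Fj1 j) else 1) * (if Fj2 j \<in> B then f (Fj2 j) else 1))"
proof -
  have B: "B = Fj1 ` {j. Fj1 j \<in> B} \<union> Fj2 ` {j. Fj2 j \<in> B}"
    using assms by (auto simp: entry_cols_def)
  have "prod f B = prod f (Fj1 ` {j. Fj1 j \<in> B}) * prod f (Fj2 ` {j. Fj2 j \<in> B})"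
    by (subst B, subst prod.union_disjoint) auto
  also have "\<dots> = (\<Prod>j | Fj1 j \<in> B. f (Fj1 j)) * (\<Prod>j | Fj2 j \<in> B. f (Fj2 j))"
    by (simp add: prod.reindex inj_on_def)
  also have "(\<Prod>j | Fj1 j \<in> B. f (Fj1 j)) = (\<Prod>j\<in>UNIV. if Fj1 j \<in> B then f (Fj1 j) else 1)"
    by (simp add: prod.If_cases)
  also have "(\<Prod>j | Fj2 j \<in> B. f (Fj2 j)) = (\<Prod>j\<in>UNIV. if Fj2 j \<in> B then f (Fj2 j) else 1)"
    by (simp add: prod.If_cases)
  finally show ?thesis by (simp add: prod.distrib)
qed

lemma card_entry_cols:
  fixes B :: "'n::finite factor set"
  assumes "B \<subseteq> entry_cols"
  shows "card B = (\<Sum>j\<in>UNIV. of_bool (Fj1 j \<in> B) + of_bool (Fj2 j \<in> B))"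
proof -
  have B: "B = Fj1 ` {j. Fj1 j \<in> B} \<union> Fj2 ` {j. Fj2 j \<in> B}"
    using assms by (auto simp: entry_cols_def)
  have "card B = card (Fj1 ` {j. Fj1 j \<in> B}) + card (Fj2 ` {j. Fj2 j \<in> B})"
    by (subst B, subst card_Un_disjoint) auto
  also have "\<dots> = card {j. Fj1 j \<in> B} + card {j. Fj2 j \<in> B}"
    by (simp add: card_image inj_on_def)
  finally show ?thesis by (simp add: sum.distrib)
qed

text \<open>The columns indexed by \<open>entry_cols\<close> do not depend on \<open>u\<close> and \<open>v\<close>, which are therefore set to \<open>0\<close>.\<close>

definition walsh :: "4 ^ 'n \<Rightarrow> 'n factor set \<Rightarrow> real" where
  "walsh a B = (\<Prod>c\<in>B. real_of_int (design 0 0 a c))"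

definition walsh_coeff :: "(4 ^ 'n \<Rightarrow> real) \<Rightarrow> 'n factor set \<Rightarrow> real" where
  "walsh_coeff f B = (\<Sum>a\<in>UNIV. f a * walsh a B) / 4 ^ CARD('n)"

text \<open>The Walsh coefficient of the character of \<open>w\<close>, as
  \<open>sum_chi_walsh\<close> shows: character and Walsh function both factor over the entries,
  hence so does the coefficient.\<close>

definition char_coeff :: "4 ^ 'n \<Rightarrow> 'n factor set \<Rightarrow> complex" where
  "char_coeff w B = (\<Prod>j\<in>UNIV. local_coeff (w $ j) (Fj1 j \<in> B) (Fj2 j \<in> B))"

lemma walsh_eq_prod:
  assumes "B \<subseteq> entry_cols"
  shows "walsh a B = (\<Prod>j\<in>UNIV. real_of_int (gray_factor (Fj1 j \<in> B) (Fj2 j \<in> B) (a $ j)))"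
  unfolding walsh_def prod_entry_cols[OF assms] by (intro prod.cong) (auto simp: gray_factor_def)

lemma sum_prod_vec:
  fixes f :: "'n::finite \<Rightarrow> 'a::finite \<Rightarrow> 'b::comm_semiring_1"
  shows "(\<Sum>a\<in>(UNIV :: ('a ^ 'n) set). \<Prod>j\<in>UNIV. f j (a $ j)) = (\<Prod>j\<in>UNIV. \<Sum>z\<in>UNIV. f j z)"
proof -
  have "bij_betw (vec_lambda :: ('n \<Rightarrow> 'a) \<Rightarrow> 'a ^ 'n) UNIV UNIV"
    by (rule bij_betw_byWitness[where f' = vec_nth]) auto
  then have "(\<Sum>a\<in>(UNIV :: ('a ^ 'n) set). \<Prod>j\<in>UNIV. f j (a $ j)) = (\<Sum>g\<in>UNIV. \<Prod>j\<in>UNIV. f j (g j))"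
    by (subst sum.reindex_bij_betw[symmetric]) auto
  then show ?thesis
    by (simp add: prod_sum_PiE)
qed

lemma sum_chi_walsh:
  fixes w :: "4 ^ 'n"
  assumes "B \<subseteq> entry_cols"
  shows "(\<Sum>a\<in>UNIV. chi (scalar_product a w) * complex_of_real (walsh a B)) = 4 ^ CARD('n) * char_coeff w B"
proof -
  have "(\<Sum>a\<in>UNIV. chi (scalar_product a w) * complex_of_real (walsh a B)) =
    (\<Sum>a\<in>UNIV. \<Prod>j\<in>UNIV. chi (w $ j * a $ j) * of_int (gray_factor (Fj1 j \<in> B) (Fj2 j \<in> B) (a $ j)))"
    by (simp add: scalar_product_def chi_sum walsh_eq_prod[OF assms] prod.distrib mult.commute)
  also have "\<dots> = (\<Prod>j\<in>UNIV. 4 * local_coeff (w $ j) (Fj1 j \<in> B) (Fj2 j \<in> B))"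
    by (subst sum_prod_vec) (simp add: local_coeff_def)
  finally show ?thesis
    by (simp add: char_coeff_def prod.distrib)
qed

lemma walsh_coeff_Re_chi:
  fixes w :: "4 ^ 'n"
  assumes "B \<subseteq> entry_cols"
  shows "walsh_coeff (\<lambda>a. Re (\<beta> * chi (scalar_product a w))) B = Re (\<beta> * char_coeff w B)"
proof -
  have "(\<Sum>a\<in>UNIV. Re (\<beta> * chi (scalar_product a w)) * walsh a B) =
     Re (\<beta> * (\<Sum>a\<in>UNIV. chi (scalar_product a w) * complex_of_real (walsh a B)))"
    by (simp add: sum_distrib_left sum_subtractf sum_distrib_right left_diff_distrib mult.assoc)
  also have "\<dots> = Re (complex_of_real (4 ^ CARD('n)) * (\<beta> * char_coeff w B))"
    by (simp only: sum_chi_walsh[OF assms]) (simp add: ac_simps)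
  finally show ?thesis
    by (simp only: walsh_coeff_def Re_complex_of_real times_complex.sel Im_complex_of_real) simp
qed

lemma walsh_coeff_add: "walsh_coeff (\<lambda>a. f a + g a) B = walsh_coeff f B + walsh_coeff g B"
  by (simp add: walsh_coeff_def distrib_right sum.distrib add_divide_distrib)

text \<open>Completeness of the Walsh functions, the dual of their orthogonality. The sum over all
  subsets is the expansion of a product of factors \<open>1 + d\<close> over the columns.\<close>

lemma sum_walsh_mult:
  fixes a b :: "4 ^ 'n"
  shows "(\<Sum>B\<in>Pow entry_cols. walsh a B * walsh b B) = (if a = b then 4 ^ CARD('n) else 0)"
proof -
  let ?d = "\<lambda>c. real_of_int (design 0 0 a c) * real_of_int (design 0 0 b c)"
  have "(\<Sum>B\<in>Pow entry_cols. walsh a B * walsh b B) = (\<Prod>c\<in>entry_cols. ?d c + 1)"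
    by (subst prod_add) (simp_all add: walsh_def prod.distrib)
  also have "\<dots> = (\<Prod>j\<in>UNIV. (?d (Fj1 j) + 1) * (?d (Fj2 j) + 1))"
    by (subst prod_entry_cols) (simp_all add: entry_cols_def)
  \<comment> \<open>The Gray map is injective, so distinct entries disagree in one of the two
    columns, where \<open>d\<close> is -1 and the factor vanishes.\<close>
  also have "\<dots> = (\<Prod>j\<in>UNIV. if a $ j = b $ j then 4 else 0)"
  proof (rule prod.cong)
    fix j
    show "(?d (Fj1 j) + 1) * (?d (Fj2 j) + 1) = (if a $ j = b $ j then 4 else 0)"
      using exhaust_Z4[of "a $ j"] exhaust_Z4[of "b $ j"]
      by (elim disjE) simp_all
  qed simp
  also have "\<dots> = (if a = b then 4 ^ CARD('n) else 0)"
    by (auto simp: vec_eq_iff)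
  finally show ?thesis .
qed

text \<open>Expanding the square and summing over \<open>B\<close> first leaves only the diagonal,
  by completeness.\<close>

lemma parseval:
  fixes f :: "4 ^ 'n \<Rightarrow> real"
  shows "(\<Sum>B\<in>Pow entry_cols. (walsh_coeff f B)\<^sup>2) = (\<Sum>a\<in>UNIV. (f a)\<^sup>2) / 4 ^ CARD('n)"
proof -
  have "(\<Sum>B\<in>Pow entry_cols. (\<Sum>a\<in>UNIV. f a * walsh a B)\<^sup>2) =
     (\<Sum>B\<in>Pow entry_cols. \<Sum>a\<in>UNIV. \<Sum>b\<in>UNIV. f a * f b * (walsh a B * walsh b B))"
    by (simp add: power2_eq_square sum_product ac_simps)
  also have "\<dots> = (\<Sum>a\<in>UNIV. \<Sum>b\<in>UNIV. \<Sum>B\<in>Pow entry_cols. f a * f b * (walsh a B * walsh b B))"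
    by (subst sum.swap, intro sum.cong refl, rule sum.swap)
  also have "\<dots> = (\<Sum>a\<in>UNIV. \<Sum>b\<in>UNIV. f a * f b * (if a = b then 4 ^ CARD('n) else 0))"
    by (simp only: sum_distrib_left[symmetric] sum_walsh_mult)
  also have "\<dots> = (\<Sum>a\<in>UNIV. (f a)\<^sup>2) * 4 ^ CARD('n)"
    by (simp add: if_distrib[of "(*) _"] sum_distrib_right power2_eq_square cong: if_cong)
  finally have "(\<Sum>B\<in>Pow entry_cols. (walsh_coeff f B)\<^sup>2) = (\<Sum>a\<in>UNIV. (f a)\<^sup>2) * 4 ^ CARD('n) / (4 ^ CARD('n))\<^sup>2"
    by (simp add: walsh_coeff_def power_divide sum_divide_distrib[symmetric])
  then show ?thesis by (simp add: power2_eq_square)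
qed

subsection \<open>Nonzero coefficients of characters\<close>

definition lee_weight :: "4 \<Rightarrow> nat" where
  "lee_weight z = (if z = 0 then 0 else if z = 2 then 2 else 1)"

lemma lee_weight_simps [simp]:
  "lee_weight 0 = 0" "lee_weight 1 = 1" "lee_weight 2 = 2" "lee_weight 3 = 1"
  by (simp_all add: lee_weight_def)

definition odd_entries :: "4 ^ 'n \<Rightarrow> 'n set" where
  "odd_entries w = {j. w $ j \<in> {1, 3}}"

lemma local_coeff_nonzero_weight:
  "local_coeff c b1 b2 \<noteq> 0 \<Longrightarrow> of_bool b1 + of_bool b2 = lee_weight c"
  using exhaust_Z4[of c] by (elim disjE; cases b1; cases b2; simp)

text \<open>A nonzero product has only nonzero local factors, and each of these fixes how many of
  the two columns of its entry are used. This is why lengths are constant.\<close>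

lemma char_coeff_nonzero_card:
  fixes w :: "4 ^ 'n"
  assumes "B \<subseteq> entry_cols" "char_coeff w B \<noteq> 0"
  shows "card B = (\<Sum>j\<in>UNIV. lee_weight (w $ j))"
  unfolding card_entry_cols[OF assms(1)] using assms(2)
  by (intro sum.cong refl local_coeff_nonzero_weight) (auto simp: char_coeff_def)

lemma local_coeff_nonzero_cases:
  assumes "local_coeff c b1 b2 \<noteq> 0"
  shows "\<exists>t. local_coeff c b1 b2 = chi t * (if c \<in> {1, 3} then (1 + \<i>) / 2 else 1)"
proof
  \<comment> \<open>The two odd values are conjugate, and \<open>1 - \<i>\<close> is
    \<open>chi 3\<close> times \<open>1 + \<i>\<close>; the exponent 3 is taken exactly where the
    conjugate occurs.\<close>
  show "local_coeff c b1 b2 =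
      chi (if c = 1 \<and> b2 \<or> c = 3 \<and> b1 then 3 else 0) * (if c \<in> {1, 3} then (1 + \<i>) / 2 else 1)"
    using exhaust_Z4[of c] assms by (elim disjE; cases b1; cases b2; simp add: field_simps)
qed

lemma prod_local_coeff_nonzero_cases:
  fixes w :: "4 ^ 'n"
  assumes "(\<Prod>j\<in>A. local_coeff (w $ j) (b1 j) (b2 j)) \<noteq> 0"
  shows "\<exists>t. (\<Prod>j\<in>A. local_coeff (w $ j) (b1 j) (b2 j)) = chi t * ((1 + \<i>) / 2) ^ card (A \<inter> odd_entries w)"
proof -
  have "\<forall>j\<in>A. \<exists>t. local_coeff (w $ j) (b1 j) (b2 j) = chi t * (if w $ j \<in> {1, 3} then (1 + \<i>) / 2 else 1)"
    using assms by (intro ballI local_coeff_nonzero_cases) auto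
  then obtain t where "\<forall>j\<in>A. local_coeff (w $ j) (b1 j) (b2 j) = chi (t j) * (if w $ j \<in> {1, 3} then (1 + \<i>) / 2 else 1)"
    by (rule bchoice[THEN exE])
  then have "(\<Prod>j\<in>A. local_coeff (w $ j) (b1 j) (b2 j)) =
      (\<Prod>j\<in>A. chi (t j) * (if w $ j \<in> {1, 3} then (1 + \<i>) / 2 else 1))"
    by (intro prod.cong) auto
  also have "\<dots> = chi (\<Sum>j\<in>A. t j) * ((1 + \<i>) / 2) ^ card (A \<inter> odd_entries w)"
    by (simp only: prod.distrib chi_sum[OF finite] prod.If_cases[OF finite]) (simp add: odd_entries_def)
  finally show ?thesis by blast
qed

lemma one_plus_ii_power_double: "\<exists>t. (1 + \<i>) ^ (2 * q) = 2 ^ q * chi t"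
proof (induction q)
  case 0
  show ?case by (auto intro: exI[of _ 0])
next
  case (Suc q)
  then obtain t where t: "(1 + \<i>) ^ (2 * q) = 2 ^ q * chi t" by blast
  have "(1 + \<i>) ^ (2 * Suc q) = (1 + \<i>) ^ (2 * q) * (1 + \<i>)\<^sup>2"
    by (simp only: mult_Suc_right power_add) (simp only: mult.commute)
  also have "(1 + \<i>)\<^sup>2 = 2 * \<i>"
    by (simp add: power2_eq_square algebra_simps)
  also have "(1 + \<i>) ^ (2 * q) * (2 * \<i>) = 2 ^ Suc q * chi (t + 1)"
    by (simp only: t chi_add chi_simps) simp
  finally show ?case by blast
qed

text \<open>The square of \<open>1 + \<i>\<close> is twice a unit. Pulling out
  \<open>k div 2\<close> such squares leaves a unit times at most one factor
  \<open>1 + \<i>\<close>, whose real part is -1, 0 or 1.\<close>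

lemma abs_Re_chi_power:
  assumes "Re (chi s * (1 + \<i>) ^ k) \<noteq> 0"
  shows "\<bar>Re (chi s * (1 + \<i>) ^ k)\<bar> = 2 ^ (k div 2)"
proof -
  obtain t where t: "(1 + \<i>) ^ (2 * (k div 2)) = 2 ^ (k div 2) * chi t"
    using one_plus_ii_power_double by blast
  have "(1 + \<i>) ^ k = (1 + \<i>) ^ (2 * (k div 2)) * (1 + \<i>) ^ (k mod 2)"
    by (simp flip: power_add)
  then have "chi s * (1 + \<i>) ^ k = complex_of_real (2 ^ (k div 2)) * (chi (s + t) * (1 + \<i>) ^ (k mod 2))"
    by (simp add: t chi_add)
  then have eq: "Re (chi s * (1 + \<i>) ^ k) = 2 ^ (k div 2) * Re (chi (s + t) * (1 + \<i>) ^ (k mod 2))"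
    by (simp only: Re_complex_of_real times_complex.sel Im_complex_of_real mult_zero_left diff_zero)
  have "Re (chi z * (1 + \<i>) ^ d) \<in> {-1, 0, 1}" if "d < 2" for z and d :: nat
    using exhaust_Z4[of z] less_2_cases[OF that] by (elim disjE) simp_all
  from this[of "k mod 2" "s + t"] have "Re (chi (s + t) * (1 + \<i>) ^ (k mod 2)) \<in> {-1, 0, 1}"
    by simp
  with assms show ?thesis
    unfolding eq by (auto simp: abs_mult)
qed

text \<open>Up to a unit, the expression has one factor \<open>1 + \<i>\<close> per odd entry and
  \<open>e\<close> more from the base columns, over one 2 per odd entry. The index set is arbitrary
  because \<open>words_uniform_product\<close> treats two complementary sets separately.\<close>

lemma abs_Re_prod_local_coeff:
  fixes w :: "4 ^ 'n"
  defines "P A b1 b2 \<equiv> \<Prod>j\<in>A. local_coeff (w $ j) (b1 j) (b2 j)"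
  assumes "Re (chi s * (1 + \<i>) ^ e * P A b1 b2) \<noteq> 0"
  shows "\<bar>Re (chi s * (1 + \<i>) ^ e * P A b1 b2)\<bar> =
     2 ^ ((card (A \<inter> odd_entries w) + e) div 2) / 2 ^ card (A \<inter> odd_entries w)"
proof -
  let ?m = "card (A \<inter> odd_entries w)"
  have "P A b1 b2 \<noteq> 0"
  proof
    assume "P A b1 b2 = 0"
    with assms(2) show False by (simp only: mult_zero_right zero_complex.sel)
  qed
  then obtain t where t: "P A b1 b2 = chi t * ((1 + \<i>) / 2) ^ ?m"
    unfolding P_def using prod_local_coeff_nonzero_cases by blast
  have "chi s * (1 + \<i>) ^ e * P A b1 b2 = (chi (s + t) * (1 + \<i>) ^ (?m + e)) / complex_of_real (2 ^ ?m)"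
    by (simp add: t chi_add power_divide power_add)
  then have eq: "Re (chi s * (1 + \<i>) ^ e * P A b1 b2) = Re (chi (s + t) * (1 + \<i>) ^ (?m + e)) / 2 ^ ?m"
    by (simp only: Re_divide_of_real)
  show ?thesis
    using assms(2) abs_Re_chi_power[of "s + t" "?m + e"] unfolding eq by (simp add: abs_divide)
qed

text \<open>By Parseval the mean square \<open>q\<close> is shared out in equal portions among the
  sets in the support. It is 1 for a product of columns and 1/2 for each half of a split
  family.\<close>

lemma card_walsh_support:
  fixes f :: "4 ^ 'n \<Rightarrow> real"
  assumes "(\<Sum>a\<in>UNIV. (f a)\<^sup>2) = q * 4 ^ CARD('n)"
    and "r > 0" "\<And>B. B \<subseteq> entry_cols \<Longrightarrow> walsh_coeff f B \<noteq> 0 \<Longrightarrow> \<bar>walsh_coeff f B\<bar> = r"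
  shows "real (card {B \<in> Pow entry_cols. walsh_coeff f B \<noteq> 0}) = q / r\<^sup>2"
proof -
  let ?W = "{B \<in> Pow entry_cols. walsh_coeff f B \<noteq> 0}"
  have "q = (\<Sum>B\<in>Pow entry_cols. (walsh_coeff f B)\<^sup>2)"
    using assms(1) by (simp add: parseval)
  also have "\<dots> = (\<Sum>B\<in>?W. (walsh_coeff f B)\<^sup>2)"
    by (rule sum.mono_neutral_right) auto
  also have "\<dots> = (\<Sum>B\<in>?W. r\<^sup>2)"
  proof (rule sum.cong)
    fix B assume "B \<in> ?W"
    then have "\<bar>walsh_coeff f B\<bar> = r" using assms(3) by auto
    then show "(walsh_coeff f B)\<^sup>2 = r\<^sup>2" by (metis power2_abs)
  qed simp
  finally show ?thesis using assms(2) by simp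
qed

lemma norm_chi [simp]: "norm (chi z) = 1"
  using exhaust_Z4[of z] by (elim disjE) simp_all

lemma scalar_product_smult: "scalar_product a (c *s w) = c * scalar_product a (w :: 4 ^ 'n)"
  by (simp add: scalar_product_def sum_distrib_left ac_simps)

text \<open>The square of a real part is half the squared norm plus half the real part of the
  square. The square is a multiple of the character of \<open>2 *s w\<close>, which is nontrivial
  once \<open>w\<close> has an odd entry and then sums to zero.\<close>

lemma sum_Re_chi_squared:
  fixes w :: "4 ^ 'n"
  assumes "odd_entries w \<noteq> {}" "norm \<beta> = 1"
  shows "(\<Sum>a\<in>UNIV. (Re (\<beta> * chi (scalar_product a w)))\<^sup>2) = 1 / 2 * 4 ^ CARD('n)"
proof -
  have Re_sq: "(Re z)\<^sup>2 = ((norm z)\<^sup>2 + Re (z\<^sup>2)) / 2" for z :: complex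
    unfolding cmod_power2 by (simp add: power2_eq_square)
  obtain j where "w $ j \<in> {1, 3}"
    using assms(1) by (auto simp: odd_entries_def)
  \<comment> \<open>The coefficient at the empty set is the mean of the character, and doubling an
    odd entry gives 2, whose local coefficient there is zero.\<close>
  then have "local_coeff ((2 *s w) $ j) False False = 0"
    by auto
  then have "char_coeff (2 *s w) {} = 0"
    unfolding char_coeff_def by (intro prod_zero) auto
  then have zero: "(\<Sum>a\<in>UNIV. chi (scalar_product a (2 *s w))) = 0"
    using sum_chi_walsh[of "{}" "2 *s w"] by (simp add: walsh_def)
  have "(\<Sum>a\<in>UNIV. (Re (\<beta> * chi (scalar_product a w)))\<^sup>2) =
     (\<Sum>a\<in>(UNIV :: (4 ^ 'n) set). 1 / 2 + Re (\<beta>\<^sup>2 / 2 * chi (scalar_product a (2 *s w))))"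
  proof (rule sum.cong)
    fix a :: "4 ^ 'n"
    let ?x = "scalar_product a w"
    have "(Re (\<beta> * chi ?x))\<^sup>2 = (1 + Re (\<beta>\<^sup>2 * (chi ?x * chi ?x))) / 2"
      unfolding Re_sq by (simp add: norm_mult assms(2) power_mult_distrib) (simp add: power2_eq_square)
    also have "chi ?x * chi ?x = chi (scalar_product a (2 *s w))"
      by (simp only: scalar_product_smult flip: chi_add) simp
    finally show "(Re (\<beta> * chi ?x))\<^sup>2 = 1 / 2 + Re (\<beta>\<^sup>2 / 2 * chi (scalar_product a (2 *s w)))"
      by (simp add: add_divide_distrib diff_divide_distrib)
  qed simp
  also have "\<dots> = 1 / 2 * 4 ^ CARD('n) + Re (\<beta>\<^sup>2 / 2 * (\<Sum>a\<in>UNIV. chi (scalar_product a (2 *s w))))"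
    by (simp only: sum.distrib sum_distrib_left Re_sum) simp
  finally show ?thesis by (simp add: zero)
qed

subsection \<open>Words of a given type\<close>

definition base_prod :: "4 ^ 'n \<Rightarrow> 4 ^ 'n \<Rightarrow> 'n factor set \<Rightarrow> 4 ^ 'n \<Rightarrow> real" where
  "base_prod u v X a = (\<Prod>c\<in>X. real_of_int (design u v a c))"

lemma gray_squared [simp]: "(fst (gray z))\<^sup>2 = 1" "(snd (gray z))\<^sup>2 = 1"
  using exhaust_Z4[of z] by (elim disjE; simp)+

lemma design_squared: "(design u v a c)\<^sup>2 = 1"
  by (cases c) simp_all

lemma base_prod_squared: "(base_prod u v X a)\<^sup>2 = 1"
  by (simp add: base_prod_def design_squared prod_power_distrib flip: of_int_power)

lemma entry_cols_iff [simp]: "F1 \<notin> entry_cols" "F2 \<notin> entry_cols" "F3 \<notin> entry_cols" "F4 \<notin> entry_cols"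
  by (auto simp: entry_cols_def)

lemma base_disjoint_entry_cols:
  assumes "X \<subseteq> {F1, F2, F3, F4}" "B \<subseteq> entry_cols"
  shows "X \<inter> B = {}"
  using assms entry_cols_iff by blast

lemma aliasing_index_eq_walsh_coeff:
  fixes u v :: "4 ^ 'n"
  assumes "X \<subseteq> {F1, F2, F3, F4}" "B \<subseteq> entry_cols"
  shows "aliasing_index u v (X \<union> B) = \<bar>walsh_coeff (base_prod u v X) B\<bar>"
proof -
  have B: "(\<Prod>c\<in>B. real_of_int (design u v a c)) = walsh a B" for a
    unfolding walsh_def using assms(2) by (intro prod.cong) (auto simp: entry_cols_def)
  have "real_of_int (\<Sum>a\<in>UNIV. \<Prod>c\<in>X \<union> B. design u v a c) = (\<Sum>a\<in>UNIV. base_prod u v X a * walsh a B)"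
    by (simp add: prod.union_disjoint base_disjoint_entry_cols[OF assms] base_prod_def B)
  moreover have "(2::real) ^ (2 * CARD('n)) = 4 ^ CARD('n)"
    by (simp add: power_mult)
  ultimately show ?thesis
    unfolding aliasing_index_def of_int_abs walsh_coeff_def by (simp add: abs_divide)
qed

text \<open>The type fixes the base columns of a set, so only its entry columns vary, and the
  aliasing index is a Walsh coefficient at these.\<close>

lemma words_eq_image:
  fixes u v :: "4 ^ 'n"
  assumes "X \<subseteq> {F1, F2, F3, F4}" "X \<noteq> {}"
  shows "words u v (factor_type X) =
    (\<union>) X ` {B \<in> Pow entry_cols. walsh_coeff (base_prod u v X) B \<noteq> 0}"
proof (intro equalityI subsetI)
  fix S assume S: "S \<in> words u v (factor_type X)"
  then have "factor_type S = factor_type X" by (simp add: words_def)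
  then have type: "F1 \<in> S \<longleftrightarrow> F1 \<in> X" "F2 \<in> S \<longleftrightarrow> F2 \<in> X" "F3 \<in> S \<longleftrightarrow> F3 \<in> X" "F4 \<in> S \<longleftrightarrow> F4 \<in> X"
    by (simp_all only: factor_type_def prod.inject of_bool_eq_iff)
  have "S = X \<union> S \<inter> entry_cols"
  proof (rule set_eqI)
    fix c show "c \<in> S \<longleftrightarrow> c \<in> X \<union> S \<inter> entry_cols"
      using type assms(1) by (cases c) (auto simp: entry_cols_def)
  qed
  moreover from this have "walsh_coeff (base_prod u v X) (S \<inter> entry_cols) \<noteq> 0"
    using S aliasing_index_eq_walsh_coeff[OF assms(1), of "S \<inter> entry_cols" u v]
    by (auto simp: words_def is_word_def)
  ultimately show "S \<in> (\<union>) X ` {B \<in> Pow entry_cols. walsh_coeff (base_prod u v X) B \<noteq> 0}"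
    by blast
next
  fix S assume "S \<in> (\<union>) X ` {B \<in> Pow entry_cols. walsh_coeff (base_prod u v X) B \<noteq> 0}"
  then obtain B where B: "S = X \<union> B" "B \<subseteq> entry_cols" "walsh_coeff (base_prod u v X) B \<noteq> 0"
    by blast
  have "F1 \<notin> B" "F2 \<notin> B" "F3 \<notin> B" "F4 \<notin> B"
    using B(2) entry_cols_iff by blast+
  then have "factor_type S = factor_type X"
    by (simp add: B(1) factor_type_def)
  then show "S \<in> words u v (factor_type X)"
    using B assms by (simp add: words_def is_word_def aliasing_index_eq_walsh_coeff)
qed

lemma inj_on_base_union:
  assumes "X \<subseteq> {F1, F2, F3, F4}"
  shows "inj_on ((\<union>) X) (Pow entry_cols)"
  using base_disjoint_entry_cols[OF assms] by (intro inj_onI) blast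

text \<open>The base product has mean square 1, so the count follows from the common absolute value
  \<open>r\<close> alone. \<open>N\<close> and \<open>k\<close> enter through equations so that they
  can take the form required in each case.\<close>

lemma words_uniformI:
  fixes u v :: "4 ^ 'n"
  assumes X: "X \<subseteq> {F1, F2, F3, F4}" "X \<noteq> {}" "factor_type X = x"
    and "r > 0" and N: "N = 1 / r\<^sup>2" and k: "k = l + card X"
    and coeff: "\<And>B. B \<subseteq> entry_cols \<Longrightarrow> walsh_coeff (base_prod u v X) B \<noteq> 0 \<Longrightarrow>
          \<bar>walsh_coeff (base_prod u v X) B\<bar> = r \<and> card B = l"
  shows "words_uniform u v x N r k"
proof -
  let ?W = "{B \<in> Pow entry_cols. walsh_coeff (base_prod u v X) B \<noteq> 0}"
  have words: "words u v x = (\<union>) X ` ?W"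
    using words_eq_image[OF X(1,2)] X(3) by simp
  have "card (words u v x) = card ?W"
    unfolding words by (rule card_image, rule inj_on_subset[OF inj_on_base_union[OF X(1)]]) auto
  also have "real \<dots> = 1 / r\<^sup>2"
    using coeff \<open>r > 0\<close> by (intro card_walsh_support) (auto simp: base_prod_squared)
  finally have "real (card (words u v x)) = N"
    by (simp add: N)
  moreover have "aliasing_index u v S = r \<and> card S = k" if "S \<in> words u v x" for S
  proof -
    from that obtain B where B: "S = X \<union> B" "B \<subseteq> entry_cols" "walsh_coeff (base_prod u v X) B \<noteq> 0"
      unfolding words by blast
    then show ?thesis
      using coeff[of B] X(1)
      by (simp add: aliasing_index_eq_walsh_coeff card_Un_disjoint base_disjoint_entry_cols k)
  qed
  ultimately show ?thesis
    by (simp add: words_uniform_def)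
qed

text \<open>Serves the types of (b) to (h), where one character suffices; \<open>e\<close> is 1 if a
  Gray half remains unpaired and 0 otherwise.\<close>

lemma words_uniform_single:
  fixes u v w :: "4 ^ 'n"
  assumes X: "X \<subseteq> {F1, F2, F3, F4}" "X \<noteq> {}" "factor_type X = x"
    and char: "\<And>a. base_prod u v X a = Re (chi s * (1 + \<i>) ^ e * chi (scalar_product a w))"
    and r: "r = 2 ^ ((card (odd_entries w) + e) div 2) / 2 ^ card (odd_entries w)"
    and N: "N = 1 / r\<^sup>2"
    and k: "k = (\<Sum>j\<in>UNIV. lee_weight (w $ j)) + card X"
  shows "words_uniform u v x N r k"
proof (rule words_uniformI[OF X _ N k])
  show "r > 0" by (simp add: r)
  fix B :: "'n factor set" assume B: "B \<subseteq> entry_cols" "walsh_coeff (base_prod u v X) B \<noteq> 0"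
  have "base_prod u v X = (\<lambda>a. Re (chi s * (1 + \<i>) ^ e * chi (scalar_product a w)))"
    by (rule ext) (rule char)
  then have eq: "walsh_coeff (base_prod u v X) B = Re (chi s * (1 + \<i>) ^ e * char_coeff w B)"
    by (simp only: walsh_coeff_Re_chi[OF B(1)])
  have "char_coeff w B \<noteq> 0"
    using B(2) unfolding eq by auto
  moreover have "\<bar>Re (chi s * (1 + \<i>) ^ e * char_coeff w B)\<bar> = r"
    using B(2) abs_Re_prod_local_coeff[where A = UNIV] unfolding eq char_coeff_def by (simp add: r)
  ultimately show "\<bar>walsh_coeff (base_prod u v X) B\<bar> = r \<and> card B = (\<Sum>j\<in>UNIV. lee_weight (w $ j))"
    using char_coeff_nonzero_card[OF B(1)] by (simp add: eq)
qed
text \<open>With disjoint supports no cancellation occurs: each coefficient of the base product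
  comes from one character alone. Both parts have mean square 1/2, since \<open>m > 0\<close>, and
  the same \<open>r\<close>, so their supports have equal size.\<close>

lemma words_half_halfI:
  fixes u v w1 w2 :: "4 ^ 'n"
  assumes X: "X \<subseteq> {F1, F2, F3, F4}" "X \<noteq> {}" "factor_type X = x"
    and char: "\<And>a. base_prod u v X a =
        Re (chi s1 * chi (scalar_product a w1)) + Re (chi s2 * chi (scalar_product a w2))"
    and disj: "\<And>B. char_coeff w1 B = 0 \<or> char_coeff w2 B = 0"
    and odd: "card (odd_entries w1) = m" "card (odd_entries w2) = m" "m > 0"
    and r: "r = 2 ^ (m div 2) / 2 ^ m" and N: "N = 1 / r\<^sup>2"
    and k1: "k1 = (\<Sum>j\<in>UNIV. lee_weight (w1 $ j)) + card X"
    and k2: "k2 = (\<Sum>j\<in>UNIV. lee_weight (w2 $ j)) + card X"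
  shows "words_half_half u v x N r k1 k2"
proof -
  define f where "f s w = (\<lambda>a. Re (chi s * chi (scalar_product a w)))" for s and w :: "4 ^ 'n"
  define W where "W s w = {B \<in> Pow entry_cols. walsh_coeff (f s w) B \<noteq> 0}" for s w
  have coeff: "walsh_coeff (f s w) B = Re (chi s * char_coeff w B)" if "B \<subseteq> entry_cols" for s w B
    unfolding f_def by (rule walsh_coeff_Re_chi[OF that])
  have nonzero: "\<bar>walsh_coeff (f s w) B\<bar> = r \<and> char_coeff w B \<noteq> 0"
    if "B \<subseteq> entry_cols" "card (odd_entries w) = m" "walsh_coeff (f s w) B \<noteq> 0" for s w B
  proof
    have *: "Re (chi s * char_coeff w B) \<noteq> 0"
      using that(3) by (simp only: coeff[OF that(1)] not_False_eq_True)
    then show "char_coeff w B \<noteq> 0"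
      by (metis mult_zero_right zero_complex.sel(1))
    show "\<bar>walsh_coeff (f s w) B\<bar> = r"
      using * abs_Re_prod_local_coeff[where A = UNIV and e = 0 and w = w and s = s] that(2)
      unfolding coeff[OF that(1)] char_coeff_def by (simp add: r)
  qed
  have "r > 0" by (simp add: r)
  have card_W: "real (card (W s w)) = 1 / 2 / r\<^sup>2" if "card (odd_entries w) = m" for s w
    unfolding W_def
  proof (rule card_walsh_support)
    show "(\<Sum>a\<in>UNIV. (f s w a)\<^sup>2) = 1 / 2 * 4 ^ CARD('n)"
      unfolding f_def using that odd(3) by (intro sum_Re_chi_squared) auto
  qed (use \<open>r > 0\<close> nonzero that in auto)
  have disj_W: "W s1 w1 \<inter> W s2 w2 = {}"
  proof (rule equals0I)
    fix B assume "B \<in> W s1 w1 \<inter> W s2 w2"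
    then show False
      using nonzero[OF _ odd(1), of B s1] nonzero[OF _ odd(2), of B s2] disj[of B] by (simp add: W_def)
  qed
  have "base_prod u v X = (\<lambda>a. f s1 w1 a + f s2 w2 a)"
    by (rule ext) (simp only: char f_def)
  then have sum: "walsh_coeff (base_prod u v X) B = walsh_coeff (f s1 w1) B + walsh_coeff (f s2 w2) B" for B
    by (simp only: walsh_coeff_add)
  have one_zero: "walsh_coeff (f s1 w1) B = 0 \<or> walsh_coeff (f s2 w2) B = 0" if "B \<subseteq> entry_cols" for B
    using disj[of B] by (auto simp: coeff[OF that])
  have "walsh_coeff (base_prod u v X) B \<noteq> 0 \<longleftrightarrow> walsh_coeff (f s1 w1) B \<noteq> 0 \<or> walsh_coeff (f s2 w2) B \<noteq> 0"
    if "B \<subseteq> entry_cols" for B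
    using one_zero[OF that] by (auto simp: sum)
  then have "{B \<in> Pow entry_cols. walsh_coeff (base_prod u v X) B \<noteq> 0} = W s1 w1 \<union> W s2 w2"
    unfolding W_def by blast
  then have words: "words u v x = (\<union>) X ` (W s1 w1 \<union> W s2 w2)"
    using words_eq_image[OF X(1,2), of u v] unfolding X(3) by simp
  have inj: "inj_on ((\<union>) X) (W s1 w1 \<union> W s2 w2)"
    by (rule inj_on_subset[OF inj_on_base_union[OF X(1)]]) (auto simp: W_def)
  have card1: "card ((\<union>) X ` W s1 w1) = card (W s1 w1)"
    by (rule card_image, rule inj_on_subset[OF inj]) auto
  have "card (words u v x) = card (W s1 w1) + card (W s2 w2)"
    unfolding words card_image[OF inj] by (rule card_Un_disjoint) (auto simp: disj_W)
  moreover have "real (card (W s1 w1)) = 1 / 2 / r\<^sup>2" "real (card (W s2 w2)) = 1 / 2 / r\<^sup>2"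
    using card_W odd by auto
  ultimately have total: "real (card (words u v x)) = N" "2 * card ((\<union>) X ` W s1 w1) = card (words u v x)"
    by (simp_all add: N card1)
  have card: "card (X \<union> B) = (\<Sum>j\<in>UNIV. lee_weight (w $ j)) + card X"
    if "B \<in> W s w" "card (odd_entries w) = m" for B s w
    using that nonzero[of B w s] X(1)
    by (simp add: W_def card_Un_disjoint base_disjoint_entry_cols char_coeff_nonzero_card)
  have len: "\<forall>S\<in>(\<union>) X ` W s1 w1. card S = k1" "\<forall>S\<in>(\<union>) X ` W s2 w2. card S = k2"
    using odd card by (auto simp: k1 k2)
  have index: "aliasing_index u v S = r" if "S \<in> words u v x" for S
  proof -
    from that obtain B where B: "S = X \<union> B" "B \<in> W s1 w1 \<union> W s2 w2"
      unfolding words by blast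
    then have "B \<subseteq> entry_cols" by (auto simp: W_def)
    with B(2) have "\<bar>walsh_coeff (f s1 w1) B + walsh_coeff (f s2 w2) B\<bar> = r"
      using one_zero[of B] nonzero[of B w1 s1] nonzero[of B w2 s2] odd by (auto simp: W_def)
    then show ?thesis
      by (simp add: B(1) aliasing_index_eq_walsh_coeff[OF X(1) \<open>B \<subseteq> entry_cols\<close>] sum)
  qed
  have sub: "words u v x - (\<union>) X ` W s1 w1 \<subseteq> (\<union>) X ` W s2 w2" "(\<union>) X ` W s1 w1 \<subseteq> words u v x"
    unfolding words by blast+
  show ?thesis
    unfolding words_half_half_def
  \<comment> \<open>The half of length \<open>k1\<close> consists of the words whose entry columns
    lie in the support of the first character.\<close>
  proof (intro conjI exI[of _ "(\<union>) X ` W s1 w1"])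
    show "\<forall>S\<in>words u v x - (\<union>) X ` W s1 w1. card S = k2"
      using sub(1) len(2) by blast
  qed (use total len(1) index sub(2) in blast)+
qed

text \<open>Without odd entries the coefficients of both characters are 0 or 1. The factor
  \<open>chi s\<close> is plus or minus \<open>\<i>\<close>, so the first term has real part zero
  and only \<open>w2\<close> contributes.\<close>

lemma words_uniform_no_odd:
  fixes u v w1 w2 :: "4 ^ 'n"
  assumes X: "X \<subseteq> {F1, F2, F3, F4}" "X \<noteq> {}" "factor_type X = x"
    and char: "\<And>a. base_prod u v X a =
        Re (chi s * chi (scalar_product a w1)) + Re (chi 0 * chi (scalar_product a w2))"
    and s: "s \<in> {1, 3}"
    and odd: "odd_entries w1 = {}" "odd_entries w2 = {}"
    and k: "k = (\<Sum>j\<in>UNIV. lee_weight (w2 $ j)) + card X"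
  shows "words_uniform u v x 1 1 k"
proof (rule words_uniformI[OF X _ _ k])
  fix B :: "'n factor set" assume B: "B \<subseteq> entry_cols" "walsh_coeff (base_prod u v X) B \<noteq> 0"
  have bit: "char_coeff w B \<in> {0, 1}" if "odd_entries w = {}" for w
  proof -
    have "local_coeff (w $ j) b1 b2 \<in> {0, 1}" for j b1 b2
      using exhaust_Z4[of "w $ j"] that by (auto simp: odd_entries_def)
    then have "char_coeff w B = 1" if "char_coeff w B \<noteq> 0"
      using that unfolding char_coeff_def by (intro prod.neutral) auto
    then show ?thesis by blast
  qed
  have "base_prod u v X = (\<lambda>a. Re (chi s * chi (scalar_product a w1)) + Re (chi 0 * chi (scalar_product a w2)))"
    by (rule ext) (rule char)
  then have "walsh_coeff (base_prod u v X) B = Re (chi s * char_coeff w1 B) + Re (chi 0 * char_coeff w2 B)"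
    by (simp only: walsh_coeff_add walsh_coeff_Re_chi[OF B(1)])
  then have "walsh_coeff (base_prod u v X) B = Re (char_coeff w2 B)"
    using bit[OF odd(1)] s by auto
  with bit[OF odd(2)] B(2) have "walsh_coeff (base_prod u v X) B = 1" "char_coeff w2 B \<noteq> 0"
    by auto
  then show "\<bar>walsh_coeff (base_prod u v X) B\<bar> = 1 \<and> card B = (\<Sum>j\<in>UNIV. lee_weight (w2 $ j))"
    using char_coeff_nonzero_card[OF B(1)] by simp
qed simp_all

section \<open>The characters of \<open>u + v\<close> and \<open>u - v\<close>\<close>

lemma scalar_product_add: "scalar_product a (u + v) = scalar_product a u + scalar_product a (v :: 4 ^ 'n)"
  by (simp add: scalar_product_def sum.distrib distrib_left)

lemma scalar_product_diff: "scalar_product a (u - v) = scalar_product a u - scalar_product a (v :: 4 ^ 'n)"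
  by (simp add: scalar_product_def sum_subtractf right_diff_distrib)

lemma odd_entries_add:
  "j \<in> odd_entries (u + v) \<longleftrightarrow> (j \<in> odd_entries u) \<noteq> (j \<in> odd_entries v)"
  using exhaust_Z4[of "u $ j"] exhaust_Z4[of "v $ j"] by (elim disjE) (simp_all add: odd_entries_def)

text \<open>Even elements of Z4 equal their negatives: if \<open>v $ j\<close> is even, sum and
  difference agree; if \<open>u $ j\<close> is even, they are negatives of each other.\<close>

lemma local_coeff_diff:
  "j \<in> odd_entries u \<Longrightarrow> j \<notin> odd_entries v \<Longrightarrow>
     local_coeff ((u - v) $ j) b1 b2 = local_coeff ((u + v) $ j) b1 b2"
  "j \<notin> odd_entries u \<Longrightarrow>
     local_coeff ((u - v) $ j) b1 b2 = cnj (local_coeff ((u + v) $ j) b1 b2)"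
  using exhaust_Z4[of "u $ j"] exhaust_Z4[of "v $ j"]
  by (elim disjE; simp add: odd_entries_def flip: local_coeff_uminus)+

text \<open>Although the sum and difference characters may overlap, their coefficients share the
  factor over the odd entries of \<open>u\<close> and have conjugate factors over the rest. So the
  coefficient is again a product of two real parts, each evaluated separately.\<close>

lemma words_uniform_product:
  fixes u v :: "4 ^ 'n"
  defines "r m \<equiv> 2 ^ ((m + 1) div 2) / 2 ^ m"
  assumes X: "X \<subseteq> {F1, F2, F3, F4}" "X \<noteq> {}" "factor_type X = x"
    and char: "\<And>a. base_prod u v X a =
        Re (chi s * (1 + \<i>) * chi (scalar_product a u)) * Re (chi t * (1 + \<i>) * chi (scalar_product a v))"
    and disj: "odd_entries u \<inter> odd_entries v = {}"
    and \<rho>: "\<rho> = r (card (odd_entries u)) * r (card (odd_entries v))"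
    and N: "N = 1 / \<rho>\<^sup>2"
    and k: "k = (\<Sum>j\<in>UNIV. lee_weight ((u + v) $ j)) + card X"
  shows "words_uniform u v x N \<rho> k"
proof (rule words_uniformI[OF X _ N k])
  show "\<rho> > 0" by (simp add: \<rho> r_def)
  fix B :: "'n factor set" assume B: "B \<subseteq> entry_cols" "walsh_coeff (base_prod u v X) B \<noteq> 0"
  define \<alpha> \<beta> where "\<alpha> = chi s * (1 + \<i>)" and "\<beta> = chi t * (1 + \<i>)"
  define P where "P A = (\<Prod>j\<in>A. local_coeff ((u + v) $ j) (Fj1 j \<in> B) (Fj2 j \<in> B))" for A
  \<comment> \<open>Used in both directions: to split the base product into two characters, and to
    reassemble their coefficients into a product.\<close>
  have Re_mult_Re: "Re x * Re y = Re (x * y / 2) + Re (x * cnj y / 2)" for x y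
    by (simp add: field_simps)
  have UNIV: "(UNIV :: 'n set) = odd_entries u \<union> - odd_entries u"
    by blast
  have sum: "char_coeff (u + v) B = P (odd_entries u) * P (- odd_entries u)"
    unfolding char_coeff_def P_def by (subst UNIV, rule prod.union_disjoint) auto
  have "char_coeff (u - v) B =
      (\<Prod>j\<in>odd_entries u. local_coeff ((u - v) $ j) (Fj1 j \<in> B) (Fj2 j \<in> B)) *
      (\<Prod>j\<in>- odd_entries u. local_coeff ((u - v) $ j) (Fj1 j \<in> B) (Fj2 j \<in> B))"
    unfolding char_coeff_def by (subst UNIV, rule prod.union_disjoint) auto
  also have "\<dots> = P (odd_entries u) * cnj (P (- odd_entries u))"
    unfolding P_def cnj_prod using disj
    by (intro arg_cong2[where f = "(*)"] prod.cong refl local_coeff_diff) auto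
  finally have diff: "char_coeff (u - v) B = P (odd_entries u) * cnj (P (- odd_entries u))" .
  have "base_prod u v X = (\<lambda>a. Re (\<alpha> * \<beta> / 2 * chi (scalar_product a (u + v))) +
      Re (\<alpha> * cnj \<beta> / 2 * chi (scalar_product a (u - v))))"
  proof
    fix a
    have "chi (scalar_product a (u - v)) = chi (scalar_product a u) * cnj (chi (scalar_product a v))"
      unfolding scalar_product_diff by (simp only: diff_conv_add_uminus chi_add chi_uminus)
    then show "base_prod u v X a = Re (\<alpha> * \<beta> / 2 * chi (scalar_product a (u + v))) +
      Re (\<alpha> * cnj \<beta> / 2 * chi (scalar_product a (u - v)))"
      unfolding char \<alpha>_def[symmetric] \<beta>_def[symmetric] Re_mult_Re
      by (simp only: scalar_product_add chi_add complex_cnj_mult times_divide_eq_left times_divide_eq_right ac_simps)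
  qed
  then have "walsh_coeff (base_prod u v X) B =
      Re (\<alpha> * \<beta> / 2 * char_coeff (u + v) B) + Re (\<alpha> * cnj \<beta> / 2 * char_coeff (u - v) B)"
    by (simp only: walsh_coeff_add walsh_coeff_Re_chi[OF B(1)])
  also have "\<dots> = Re (\<alpha> * P (odd_entries u)) * Re (\<beta> * P (- odd_entries u))"
    unfolding sum diff Re_mult_Re by (simp only: complex_cnj_mult times_divide_eq_left times_divide_eq_right ac_simps)
  finally have eq: "walsh_coeff (base_prod u v X) B = Re (\<alpha> * P (odd_entries u)) * Re (\<beta> * P (- odd_entries u))" .
  have abs: "\<bar>Re (chi z * (1 + \<i>) * P A)\<bar> = r (card (A \<inter> odd_entries (u + v)))"
    if "Re (chi z * (1 + \<i>) * P A) \<noteq> 0" for z A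
    using abs_Re_prod_local_coeff[where A = A and e = 1 and w = "u + v"] that
    unfolding P_def r_def by simp
  have "odd_entries u \<inter> odd_entries (u + v) = odd_entries u" "- odd_entries u \<inter> odd_entries (u + v) = odd_entries v"
    using disj by (auto simp: odd_entries_add)
  then have "\<bar>walsh_coeff (base_prod u v X) B\<bar> = \<rho>"
    using B(2) abs unfolding eq \<rho> abs_mult \<alpha>_def \<beta>_def by (metis mult_zero_left mult_zero_right)
  moreover have "char_coeff (u + v) B \<noteq> 0"
    using B(2) unfolding eq sum by (auto simp del: times_complex.sel)
  ultimately show "\<bar>walsh_coeff (base_prod u v X) B\<bar> = \<rho> \<and> card B = (\<Sum>j\<in>UNIV. lee_weight ((u + v) $ j))"
    using char_coeff_nonzero_card[OF B(1)] by simp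
qed

text \<open>At a common odd index one of the two vectors has entry 0 and the other 2; the first
  demands neither column of that index, the second both.\<close>

lemma char_coeff_add_diff_disjoint:
  assumes "odd_entries u \<inter> odd_entries v \<noteq> {}"
  shows "char_coeff (u + v) B = 0 \<or> char_coeff (u - v) B = 0"
proof -
  obtain j where j: "j \<in> odd_entries u" "j \<in> odd_entries v"
    using assms by blast
  then have "local_coeff ((u + v) $ j) b1 b2 = 0 \<or> local_coeff ((u - v) $ j) b1 b2 = 0" for b1 b2
    by (auto simp: odd_entries_def)
  then show ?thesis
    unfolding char_coeff_def by (meson UNIV_I finite prod_zero)
qed

subsection \<open>The parameters of the design\<close>

text \<open>Grouping the indices by their pair of values turns weights and parity counts into
  sixteen-term sums of frequencies.\<close>

lemma sum_eq_sum_freq: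
  fixes u v :: "4 ^ 'n" and g :: "4 \<Rightarrow> 4 \<Rightarrow> nat"
  shows "(\<Sum>j\<in>UNIV. g (u $ j) (v $ j)) = (\<Sum>k\<in>UNIV. \<Sum>s\<in>UNIV. g k s * freq u v k s)"
proof -
  have "(\<Sum>k\<in>UNIV. \<Sum>s\<in>UNIV. g k s * freq u v k s) =
      (\<Sum>k\<in>UNIV. \<Sum>s\<in>UNIV. \<Sum>j\<in>UNIV. if u $ j = k \<and> v $ j = s then g k s else 0)"
    by (simp add: freq_def sum.If_cases mult.commute)
  also have "\<dots> = (\<Sum>j\<in>UNIV. \<Sum>k\<in>UNIV. \<Sum>s\<in>UNIV. if u $ j = k \<and> v $ j = s then g k s else 0)"
    by (subst sum.swap[of _ UNIV "UNIV :: 'n set"], intro sum.cong refl, rule sum.swap)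
  also have "\<dots> = (\<Sum>j\<in>UNIV. g (u $ j) (v $ j))"
    by (intro sum.cong refl) (simp add: if_if_eq_conj[symmetric] sum.If_cases)
  finally show ?thesis ..
qed

lemmas lam_defs = lam1_def lam2_def lam3_def lam4_def lam5_def lam6_def lam7_def lam8_def lam9_def

text \<open>The lengths are the Lee weights of the vectors whose characters occur. \<open>l8\<close>
  is missing because it is \<open>l9\<close> with \<open>lam5 = 0\<close>.\<close>

lemma sum_lee_weight:
  "(\<Sum>j\<in>UNIV. lee_weight (u $ j)) = l1 u v"
  "(\<Sum>j\<in>UNIV. lee_weight (v $ j)) = l2 u v"
  "(\<Sum>j\<in>UNIV. lee_weight ((u + 2 *s v) $ j)) = l3 u v"
  "(\<Sum>j\<in>UNIV. lee_weight ((2 *s u + v) $ j)) = l4 u v"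
  "(\<Sum>j\<in>UNIV. lee_weight ((2 *s u) $ j)) = l5 u v"
  "(\<Sum>j\<in>UNIV. lee_weight ((2 *s v) $ j)) = l6 u v"
  "(\<Sum>j\<in>UNIV. lee_weight ((2 *s u + 2 *s v) $ j)) = l7 u v"
  "(\<Sum>j\<in>UNIV. lee_weight ((u + v) $ j)) = l9 u v"
  "(\<Sum>j\<in>UNIV. lee_weight ((u - v) $ j)) = l10 u v"
  using sum_eq_sum_freq[of "\<lambda>x y. lee_weight x" u v] sum_eq_sum_freq[of "\<lambda>x y. lee_weight y" u v]
    sum_eq_sum_freq[of "\<lambda>x y. lee_weight (x + 2 * y)" u v] sum_eq_sum_freq[of "\<lambda>x y. lee_weight (2 * x + y)" u v]
    sum_eq_sum_freq[of "\<lambda>x y. lee_weight (2 * x)" u v] sum_eq_sum_freq[of "\<lambda>x y. lee_weight (2 * y)" u v]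
    sum_eq_sum_freq[of "\<lambda>x y. lee_weight (2 * x + 2 * y)" u v]
    sum_eq_sum_freq[of "\<lambda>x y. lee_weight (x + y)" u v] sum_eq_sum_freq[of "\<lambda>x y. lee_weight (x - y)" u v]
  by (simp_all add: sum_4 lam_defs l1_def l2_def l3_def l4_def l5_def l6_def l7_def l9_def l10_def)

lemma card_odd_entries_sum: "card (odd_entries w) = (\<Sum>j\<in>UNIV. if w $ j \<in> {1, 3} then 1 else 0)"
  by (simp add: odd_entries_def sum.If_cases)

lemma card_odd_entries_Int:
  "card (odd_entries u \<inter> odd_entries v) = (\<Sum>j\<in>UNIV. if u $ j \<in> {1, 3} \<and> v $ j \<in> {1, 3} then 1 else 0)"
  by (simp add: odd_entries_def sum.If_cases Collect_conj_eq)

lemma card_odd_entries: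
  "card (odd_entries u) = lam1 u v + lam3 u v + lam5 u v + lam6 u v"
  "card (odd_entries v) = lam2 u v + lam4 u v + lam5 u v + lam6 u v"
  "card (odd_entries (u + v)) = lam1 u v + lam2 u v + lam3 u v + lam4 u v"
  "card (odd_entries (u - v)) = lam1 u v + lam2 u v + lam3 u v + lam4 u v"
  "card (odd_entries u \<inter> odd_entries v) = lam5 u v + lam6 u v"
  using sum_eq_sum_freq[of "\<lambda>x y. if x \<in> {1, 3} then 1 else 0" u v]
    sum_eq_sum_freq[of "\<lambda>x y. if y \<in> {1, 3} then 1 else 0" u v]
    sum_eq_sum_freq[of "\<lambda>x y. if x + y \<in> {1, 3} then 1 else 0" u v]
    sum_eq_sum_freq[of "\<lambda>x y. if x - y \<in> {1, 3} then 1 else 0" u v]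
    sum_eq_sum_freq[of "\<lambda>x y. if x \<in> {1, 3} \<and> y \<in> {1, 3} then 1 else 0" u v]
  by (simp_all add: sum_4 lam_defs card_odd_entries_sum card_odd_entries_Int)

lemma odd_entries_double [simp]:
  fixes u v :: "4 ^ 'n"
  shows
  "odd_entries (2 *s u) = {}"
  "odd_entries (u + 2 *s v) = odd_entries u"
  "odd_entries (2 *s u + v) = odd_entries v"
proof -
  have *: "odd_entries (2 *s w) = {}" for w :: "4 ^ 'n"
  proof -
    have "(2 *s w) $ j \<notin> {1, 3}" for j
      using exhaust_Z4[of "w $ j"] by (elim disjE) simp_all
    then show ?thesis by (auto simp: odd_entries_def)
  qed
  show "odd_entries (2 *s u) = {}" "odd_entries (u + 2 *s v) = odd_entries u" "odd_entries (2 *s u + v) = odd_entries v"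
    by (auto simp: odd_entries_add *)
qed

lemma two_powi_minus_half: "2 powi - \<lfloor>real m / 2\<rfloor> = (1 / 2 ^ (m div 2) :: real)"
proof -
  have "\<lfloor>real m / 2\<rfloor> = int (m div 2)"
    using floor_divide_of_nat_eq[of m 2] by simp
  then show ?thesis by (simp only: power_int_minus power_int_of_nat inverse_eq_divide)
qed

text \<open>\<open>m\<close> is the sum of its half rounded down and its half rounded up. This
  converts the absolute values of coefficients into the form of \<open>rho1\<close>,
  \<open>rho2\<close> and \<open>xi\<close>.\<close>

lemma two_power_half:
  "(2::real) ^ ((m + 1) div 2) / 2 ^ m = 1 / 2 ^ (m div 2)"
  "(2::real) ^ (m div 2) / 2 ^ m = 1 / 2 ^ ((m + 1) div 2)"
proof -
  have "m = (m + 1) div 2 + m div 2"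
    by simp
  then have "(2::real) ^ m = 2 ^ ((m + 1) div 2) * 2 ^ (m div 2)"
    by (metis power_add)
  then show "(2::real) ^ ((m + 1) div 2) / 2 ^ m = 1 / 2 ^ (m div 2)"
    "(2::real) ^ (m div 2) / 2 ^ m = 1 / 2 ^ ((m + 1) div 2)"
    by simp_all
qed

subsection \<open>The sixteen types\<close>

text \<open>The two Gray halves of one element multiply to the real character of its double. An
  unpaired half contributes \<open>1 - \<i>\<close>, written \<open>chi 3 * (1 + \<i>)\<close>, or
  \<open>1 + \<i>\<close>.\<close>

lemma base_prod_single:
  "base_prod u v {F1} a = Re (chi 3 * (1 + \<i>) ^ 1 * chi (scalar_product a u))"
  "base_prod u v {F2} a = Re (chi 0 * (1 + \<i>) ^ 1 * chi (scalar_product a u))"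
  "base_prod u v {F3} a = Re (chi 3 * (1 + \<i>) ^ 1 * chi (scalar_product a v))"
  "base_prod u v {F4} a = Re (chi 0 * (1 + \<i>) ^ 1 * chi (scalar_product a v))"
  "base_prod u v {F1, F2} a = Re (chi 0 * (1 + \<i>) ^ 0 * chi (scalar_product a (2 *s u)))"
  "base_prod u v {F3, F4} a = Re (chi 0 * (1 + \<i>) ^ 0 * chi (scalar_product a (2 *s v)))"
  "base_prod u v {F1, F3, F4} a = Re (chi 3 * (1 + \<i>) ^ 1 * chi (scalar_product a (u + 2 *s v)))"
  "base_prod u v {F2, F3, F4} a = Re (chi 0 * (1 + \<i>) ^ 1 * chi (scalar_product a (u + 2 *s v)))"
  "base_prod u v {F1, F2, F3} a = Re (chi 3 * (1 + \<i>) ^ 1 * chi (scalar_product a (2 *s u + v)))"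
  "base_prod u v {F1, F2, F4} a = Re (chi 0 * (1 + \<i>) ^ 1 * chi (scalar_product a (2 *s u + v)))"
  "base_prod u v {F1, F2, F3, F4} a = Re (chi 0 * (1 + \<i>) ^ 0 * chi (scalar_product a (2 *s u + 2 *s v)))"
  unfolding base_prod_def scalar_product_add scalar_product_smult
  using exhaust_Z4[of "scalar_product a u"] exhaust_Z4[of "scalar_product a v"]
  by (elim disjE; simp)+

text \<open>Half the products of the factors \<open>1 - \<i>\<close> and \<open>1 + \<i>\<close>,
  the second possibly conjugated, give the units. The term with an imaginary unit stands first, as
  \<open>words_uniform_no_odd\<close> expects.\<close>

lemma base_prod_sum:
  "base_prod u v {F1, F3} a = Re (chi 3 * chi (scalar_product a (u + v))) + Re (chi 0 * chi (scalar_product a (u - v)))"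
  "base_prod u v {F2, F4} a = Re (chi 1 * chi (scalar_product a (u + v))) + Re (chi 0 * chi (scalar_product a (u - v)))"
  "base_prod u v {F1, F4} a = Re (chi 3 * chi (scalar_product a (u - v))) + Re (chi 0 * chi (scalar_product a (u + v)))"
  "base_prod u v {F2, F3} a = Re (chi 1 * chi (scalar_product a (u - v))) + Re (chi 0 * chi (scalar_product a (u + v)))"
  unfolding base_prod_def scalar_product_add scalar_product_diff
  using exhaust_Z4[of "scalar_product a u"] exhaust_Z4[of "scalar_product a v"]
  by (elim disjE; simp)+

text \<open>The unexpanded form, used when \<open>u\<close> and \<open>v\<close> have no common odd
  index.\<close>

lemma base_prod_product:
  "base_prod u v {F1, F3} a = Re (chi 3 * (1 + \<i>) * chi (scalar_product a u)) * Re (chi 3 * (1 + \<i>) * chi (scalar_product a v))"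
  "base_prod u v {F2, F4} a = Re (chi 0 * (1 + \<i>) * chi (scalar_product a u)) * Re (chi 0 * (1 + \<i>) * chi (scalar_product a v))"
  "base_prod u v {F1, F4} a = Re (chi 3 * (1 + \<i>) * chi (scalar_product a u)) * Re (chi 0 * (1 + \<i>) * chi (scalar_product a v))"
  "base_prod u v {F2, F3} a = Re (chi 0 * (1 + \<i>) * chi (scalar_product a u)) * Re (chi 3 * (1 + \<i>) * chi (scalar_product a v))"
  by (simp_all add: base_prod_def fst_gray snd_gray algebra_simps)

lemma rho_xi_eq:
  "rho1 u v = 2 ^ ((card (odd_entries u) + 1) div 2) / 2 ^ card (odd_entries u)"
  "rho2 u v = 2 ^ ((card (odd_entries v) + 1) div 2) / 2 ^ card (odd_entries v)"
  "xi u v = 2 ^ (card (odd_entries (u + v)) div 2) / 2 ^ card (odd_entries (u + v))"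
  by (simp_all only: rho1_def rho2_def xi_def two_powi_minus_half two_power_half
      card_odd_entries[where u = u and v = v])

lemma xi1_xi2_eq:
  assumes "lam5 u v + lam6 u v = 0"
  shows "xi1 u v * xi2 u v = 2 ^ ((card (odd_entries u) + 1) div 2) / 2 ^ card (odd_entries u) *
      (2 ^ ((card (odd_entries v) + 1) div 2) / 2 ^ card (odd_entries v))"
proof -
  have "lam5 u v = 0" "lam6 u v = 0"
    using assms by simp_all
  then show ?thesis
    by (simp only: xi1_def xi2_def two_powi_minus_half two_power_half
        card_odd_entries[where u = u and v = v] add_0_right)
qed

text \<open>The empty base product is the trivial character, of Lee weight 0, so only the empty set
  has a nonzero coefficient.\<close>

lemma words_no_base_factor: "words u v (0, 0, 0, 0) = {}"
proof -
  have False if S: "S \<in> words u v (0, 0, 0, 0)" for S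
  proof -
    have "F1 \<notin> S" "F2 \<notin> S" "F3 \<notin> S" "F4 \<notin> S"
      using S by (auto simp: words_def factor_type_def split: if_splits)
    then have entry: "c \<in> S \<Longrightarrow> c \<in> entry_cols" for c
      by (cases c) (auto simp: entry_cols_def)
    then have sub: "S \<subseteq> entry_cols" by blast
    have "base_prod u v {} = (\<lambda>a. Re (1 * chi (scalar_product a 0)))"
      by (rule ext) (simp add: base_prod_def scalar_product_def)
    then have "walsh_coeff (base_prod u v {}) S = Re (1 * char_coeff 0 S)"
      by (simp only: walsh_coeff_Re_chi[OF sub])
    moreover have "walsh_coeff (base_prod u v {}) S \<noteq> 0" "S \<noteq> {}"
      using S aliasing_index_eq_walsh_coeff[of "{}" S u v] sub by (auto simp: words_def is_word_def)
    ultimately have "card S = 0"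
      using char_coeff_nonzero_card[OF sub, of 0] by fastforce
    with \<open>S \<noteq> {}\<close> show False by simp
  qed
  then show ?thesis by blast
qed

lemma words_uniform_pair:
  fixes u v :: "4 ^ 'n" and X :: "'n factor set"
  assumes "X = {F1, F3} \<or> X = {F2, F4} \<or> X = {F1, F4} \<or> X = {F2, F3}" "lam5 u v + lam6 u v = 0"
  shows "words_uniform u v (factor_type X) (1 / ((xi1 u v)\<^sup>2 * (xi2 u v)\<^sup>2)) (xi1 u v * xi2 u v) (l8 u v + 2)"
proof -
  have disj: "odd_entries u \<inter> odd_entries v = {}"
    using card_odd_entries(5)[of u v] assms(2) by simp
  have X: "card X = 2" "X \<subseteq> {F1, F2, F3, F4}" "X \<noteq> {}"
    using assms(1) by auto
  \<comment> \<open>Here \<open>lam5\<close> is zero, so the Lee weight of \<open>u + v\<close> is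
    \<open>l8\<close>.\<close>
  have "l8 u v = l9 u v"
    using assms(2) by (simp add: l8_def l9_def)
  then have k: "l8 u v + 2 = (\<Sum>j\<in>UNIV. lee_weight ((u + v) $ j)) + card X"
    by (simp only: sum_lee_weight[where u = u and v = v] X(1))
  have "\<exists>s t. \<forall>a. base_prod u v X a =
        Re (chi s * (1 + \<i>) * chi (scalar_product a u)) * Re (chi t * (1 + \<i>) * chi (scalar_product a v))"
    using assms(1) by (elim disjE) (simp only:, intro exI allI, rule base_prod_product)+
  then obtain s t where char: "\<And>a. base_prod u v X a =
        Re (chi s * (1 + \<i>) * chi (scalar_product a u)) * Re (chi t * (1 + \<i>) * chi (scalar_product a v))"
    by blast
  show ?thesis
    by (rule words_uniform_product[OF X(2,3) refl char disj xi1_xi2_eq[OF assms(2)] _ k])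
      (simp only: power_mult_distrib)
qed

lemma words_half_half_pair:
  fixes u v :: "4 ^ 'n" and X :: "'n factor set"
  assumes X: "X = {F1, F3} \<or> X = {F2, F4} \<or> X = {F1, F4} \<or> X = {F2, F3}"
    and lam: "lam5 u v + lam6 u v > 0" "lam1 u v + lam2 u v + lam3 u v + lam4 u v > 0"
  shows "words_half_half u v (factor_type X) (1 / (xi u v)\<^sup>2) (xi u v) (l9 u v + 2) (l10 u v + 2)"
proof -
  have "odd_entries u \<inter> odd_entries v \<noteq> {}"
    using card_odd_entries(5)[of u v] lam(1) by force
  note disj = char_coeff_add_diff_disjoint[OF this]
  have card: "card (odd_entries (u - v)) = card (odd_entries (u + v))" "card (odd_entries (u + v)) > 0"
    using card_odd_entries[of u v] lam(2) by simp_all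
  have X': "card X = 2" "X \<subseteq> {F1, F2, F3, F4}" "X \<noteq> {}"
    using X by auto
  have "\<exists>s t. \<forall>a. base_prod u v X a =
        Re (chi s * chi (scalar_product a (u + v))) + Re (chi t * chi (scalar_product a (u - v)))"
    using X
  proof (elim disjE)
    assume "X = {F1, F3}"
    then show ?thesis using base_prod_sum(1) by blast
  next
    assume "X = {F2, F4}"
    then show ?thesis using base_prod_sum(2) by blast
  next
    assume "X = {F1, F4}"
    \<comment> \<open>The terms are swapped to put \<open>u + v\<close> first, so that the first
      half has length \<open>l9 u v + 2\<close>.\<close>
    then show ?thesis using base_prod_sum(3)[THEN trans, OF add.commute] by blast
  next
    assume "X = {F2, F3}"
    then show ?thesis using base_prod_sum(4)[THEN trans, OF add.commute] by blast
  qed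
  then obtain s t where char: "\<And>a. base_prod u v X a =
        Re (chi s * chi (scalar_product a (u + v))) + Re (chi t * chi (scalar_product a (u - v)))"
    by blast
  show ?thesis
    by (rule words_half_halfI[OF X'(2,3) refl char disj refl card rho_xi_eq(3) refl])
      (simp_all only: X'(1) sum_lee_weight[where u = u and v = v])
qed

theorem theorem1:
  fixes u v :: "4 ^ 'n"
  shows
    "words u v (0,0,0,0) = {}
   \<and> (\<forall>x\<in>{(0,1,0,0), (1,0,0,0)}. words_uniform u v x (1 / (rho1 u v)\<^sup>2) (rho1 u v) (l1 u v + 1))
   \<and> (\<forall>x\<in>{(0,0,0,1), (0,0,1,0)}. words_uniform u v x (1 / (rho2 u v)\<^sup>2) (rho2 u v) (l2 u v + 1))
   \<and> (\<forall>x\<in>{(0,1,1,1), (1,0,1,1)}. words_uniform u v x (1 / (rho1 u v)\<^sup>2) (rho1 u v) (l3 u v + 3))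
   \<and> (\<forall>x\<in>{(1,1,0,1), (1,1,1,0)}. words_uniform u v x (1 / (rho2 u v)\<^sup>2) (rho2 u v) (l4 u v + 3))
   \<and> words_uniform u v (1,1,0,0) 1 1 (l5 u v + 2)
   \<and> words_uniform u v (0,0,1,1) 1 1 (l6 u v + 2)
   \<and> words_uniform u v (1,1,1,1) 1 1 (l7 u v + 4)
   \<and> (\<forall>x\<in>{(0,1,0,1), (1,0,1,0)}.
        (lam5 u v + lam6 u v = 0 \<longrightarrow>
           words_uniform u v x (1 / ((xi1 u v)\<^sup>2 * (xi2 u v)\<^sup>2)) (xi1 u v * xi2 u v) (l8 u v + 2))
      \<and> (lam5 u v + lam6 u v > 0 \<and> lam1 u v + lam2 u v + lam3 u v + lam4 u v = 0 \<longrightarrow>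
           words_uniform u v x 1 1 (l10 u v + 2))
      \<and> (lam5 u v + lam6 u v > 0 \<and> lam1 u v + lam2 u v + lam3 u v + lam4 u v > 0 \<longrightarrow>
           words_half_half u v x (1 / (xi u v)\<^sup>2) (xi u v) (l9 u v + 2) (l10 u v + 2)))
   \<and> (\<forall>x\<in>{(0,1,1,0), (1,0,0,1)}.
        (lam5 u v + lam6 u v = 0 \<longrightarrow>
           words_uniform u v x (1 / ((xi1 u v)\<^sup>2 * (xi2 u v)\<^sup>2)) (xi1 u v * xi2 u v) (l8 u v + 2))
      \<and> (lam5 u v + lam6 u v > 0 \<and> lam1 u v + lam2 u v + lam3 u v + lam4 u v = 0 \<longrightarrow>
           words_uniform u v x 1 1 (l9 u v + 2))
      \<and> (lam5 u v + lam6 u v > 0 \<and> lam1 u v + lam2 u v + lam3 u v + lam4 u v > 0 \<longrightarrow>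
           words_half_half u v x (1 / (xi u v)\<^sup>2) (xi u v) (l9 u v + 2) (l10 u v + 2)))"
proof -
  note single = words_uniform_single[where u = u and v = v]
  note lee = sum_lee_weight[where u = u and v = v]
  have types: "factor_type {F1 :: 'n factor} = (1,0,0,0)" "factor_type {F2 :: 'n factor} = (0,1,0,0)"
    "factor_type {F3 :: 'n factor} = (0,0,1,0)" "factor_type {F4 :: 'n factor} = (0,0,0,1)"
    "factor_type {F1, F2 :: 'n factor} = (1,1,0,0)" "factor_type {F3, F4 :: 'n factor} = (0,0,1,1)"
    "factor_type {F1, F3, F4 :: 'n factor} = (1,0,1,1)" "factor_type {F2, F3, F4 :: 'n factor} = (0,1,1,1)"
    "factor_type {F1, F2, F3 :: 'n factor} = (1,1,1,0)" "factor_type {F1, F2, F4 :: 'n factor} = (1,1,0,1)"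
    "factor_type {F1, F2, F3, F4 :: 'n factor} = (1,1,1,1)"
    "factor_type {F1, F3 :: 'n factor} = (1,0,1,0)" "factor_type {F2, F4 :: 'n factor} = (0,1,0,1)"
    "factor_type {F1, F4 :: 'n factor} = (1,0,0,1)" "factor_type {F2, F3 :: 'n factor} = (0,1,1,0)"
    by (simp_all add: factor_type_def)
  have no_odd: "odd_entries (u + v) = {}" "odd_entries (u - v) = {}"
    if "lam1 u v + lam2 u v + lam3 u v + lam4 u v = 0"
    using that card_odd_entries(3,4)[of u v] by simp_all
  have b: "words_uniform u v (0,1,0,0) (1 / (rho1 u v)\<^sup>2) (rho1 u v) (l1 u v + 1)"
       "words_uniform u v (1,0,0,0) (1 / (rho1 u v)\<^sup>2) (rho1 u v) (l1 u v + 1)"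
    by (rule single[OF _ _ types(2) base_prod_single(2)] single[OF _ _ types(1) base_prod_single(1)];
        simp add: rho_xi_eq lee)+
  have c: "words_uniform u v (0,0,0,1) (1 / (rho2 u v)\<^sup>2) (rho2 u v) (l2 u v + 1)"
       "words_uniform u v (0,0,1,0) (1 / (rho2 u v)\<^sup>2) (rho2 u v) (l2 u v + 1)"
    by (rule single[OF _ _ types(4) base_prod_single(4)] single[OF _ _ types(3) base_prod_single(3)];
        simp add: rho_xi_eq lee)+
  have d: "words_uniform u v (0,1,1,1) (1 / (rho1 u v)\<^sup>2) (rho1 u v) (l3 u v + 3)"
       "words_uniform u v (1,0,1,1) (1 / (rho1 u v)\<^sup>2) (rho1 u v) (l3 u v + 3)"
    by (rule single[OF _ _ types(8) base_prod_single(8)] single[OF _ _ types(7) base_prod_single(7)];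
        simp add: rho_xi_eq lee del: vector_add_component vector_smult_component)+
  have e: "words_uniform u v (1,1,0,1) (1 / (rho2 u v)\<^sup>2) (rho2 u v) (l4 u v + 3)"
       "words_uniform u v (1,1,1,0) (1 / (rho2 u v)\<^sup>2) (rho2 u v) (l4 u v + 3)"
    by (rule single[OF _ _ types(10) base_prod_single(10)] single[OF _ _ types(9) base_prod_single(9)];
        simp add: rho_xi_eq lee del: vector_add_component vector_smult_component)+
  have f: "words_uniform u v (1,1,0,0) 1 1 (l5 u v + 2)"
    by (rule single[OF _ _ types(5) base_prod_single(5)];
        simp add: lee del: vector_smult_component)
  have g: "words_uniform u v (0,0,1,1) 1 1 (l6 u v + 2)"
    by (rule single[OF _ _ types(6) base_prod_single(6)];
        simp add: lee del: vector_smult_component)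
  have h: "words_uniform u v (1,1,1,1) 1 1 (l7 u v + 4)"
    by (rule single[OF _ _ types(11) base_prod_single(11)];
        simp add: lee del: vector_add_component vector_smult_component)
  \<comment> \<open>For these types \<open>u - v\<close> carries the real unit and survives, giving
    \<open>l10\<close>; for the two types that follow it is \<open>u + v\<close>, giving
    \<open>l9\<close>.\<close>
  have i: "words_uniform u v (0,1,0,1) 1 1 (l10 u v + 2)" "words_uniform u v (1,0,1,0) 1 1 (l10 u v + 2)"
    if "lam1 u v + lam2 u v + lam3 u v + lam4 u v = 0"
    by (rule words_uniform_no_odd[OF _ _ types(13) base_prod_sum(2)] words_uniform_no_odd[OF _ _ types(12) base_prod_sum(1)];
        simp add: no_odd[OF that] lee del: vector_minus_component)+
  have j: "words_uniform u v (0,1,1,0) 1 1 (l9 u v + 2)" "words_uniform u v (1,0,0,1) 1 1 (l9 u v + 2)"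
    if "lam1 u v + lam2 u v + lam3 u v + lam4 u v = 0"
    by (rule words_uniform_no_odd[OF _ _ types(15) base_prod_sum(4)] words_uniform_no_odd[OF _ _ types(14) base_prod_sum(3)];
        simp add: no_odd[OF that] lee del: vector_add_component)+
  have pairs: "\<forall>x\<in>{(0,1,0,1), (1,0,1,0), (0,1,1,0), (1,0,0,1)}.
      \<exists>X :: 'n factor set. (X = {F1, F3} \<or> X = {F2, F4} \<or> X = {F1, F4} \<or> X = {F2, F3}) \<and> factor_type X = x"
    using types(12-15) by blast
  have unif: "words_uniform u v x (1 / ((xi1 u v)\<^sup>2 * (xi2 u v)\<^sup>2)) (xi1 u v * xi2 u v) (l8 u v + 2)"
    if "x \<in> {(0,1,0,1), (1,0,1,0), (0,1,1,0), (1,0,0,1)}" "lam5 u v + lam6 u v = 0" for x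
  proof -
    obtain X :: "'n factor set" where X: "X = {F1, F3} \<or> X = {F2, F4} \<or> X = {F1, F4} \<or> X = {F2, F3}" "factor_type X = x"
      using pairs \<open>x \<in> _\<close> by blast
    show ?thesis
      using words_uniform_pair[OF X(1) that(2)] unfolding X(2) .
  qed
  have half: "words_half_half u v x (1 / (xi u v)\<^sup>2) (xi u v) (l9 u v + 2) (l10 u v + 2)"
    if "x \<in> {(0,1,0,1), (1,0,1,0), (0,1,1,0), (1,0,0,1)}" "lam5 u v + lam6 u v > 0"
      "lam1 u v + lam2 u v + lam3 u v + lam4 u v > 0" for x
  proof -
    obtain X :: "'n factor set" where X: "X = {F1, F3} \<or> X = {F2, F4} \<or> X = {F1, F4} \<or> X = {F2, F3}" "factor_type X = x"
      using pairs \<open>x \<in> _\<close> by blast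
    show ?thesis
      using words_half_half_pair[OF X(1) that(2,3)] unfolding X(2) .
  qed
  show ?thesis
    using words_no_base_factor b c d e f g h i j unif half by simp
qed

end
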